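(* Let $\alpha_0,\dots,\alpha_4$ be complex parameters with $\alpha_0+\alpha_1+2\alpha_2+\alpha_3+\alpha_4=1$, and consider the autonomous system of ordinary differential equations in the unknowns $f_0,f_1,f_2,f_3,f_4,g_1,g_2$ $$ \begin{aligned} \frac{df_0}{dt} &=-(2f_1g_1+\alpha_1)f_0-\alpha_0f_1,\\ \frac{df_1}{dt} &=-(2f_0g_1+\alpha_0)f_1-\alpha_1f_0,\\ \frac{df_2}{dt} &=\{(f_0+f_1)g_1+(f_3+f_4)g_2+1\}f_2-2\alpha_2 g_1g_2,\\ \frac{df_3}{dt} &=-(2f_4g_2+\alpha_4)f_3-\alpha_3f_4,\\ \frac{df_4}{dt} &=-(2f_3g_2+\alpha_3)f_4-\alpha_4f_3,\\ \frac{dg_1}{dt} &=(f_0+f_1)g_1^2-\{(f_3+f_4)g_2-\alpha_0-\alpha_1\}g_1+(f_3+f_4)f_2,\\ \frac{dg_2}{dt} &=(f_3+f_4)g_2^2-\{(f_0+f_1)g_1-\alpha_3-\alpha_4\}g_2+(f_0+f_1)f_2. \end{aligned} $$ This system has the two first integrals $f_0-f_1$ and $f_3-f_4$, and $f_2-g_1g_2$ satisfies a linear equation; precisely, along every solution, $$ \frac{d(f_0-f_1)}{dt}=\frac{d(f_3-f_4)}{dt}=0,\qquad \frac{d(f_2-g_1g_2)}{dt}=f_2-g_1g_2 . $$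
   Context: All unknowns are complex variables and $t$ is the (complex) independent variable. *)

theory Defs
  imports "HOL-Complex_Analysis.Complex_Analysis"
begin

datatype state =
  State (f0: complex) (f1: complex) (f2: complex) (f3: complex) (f4: complex)
    (g1: complex) (g2: complex)

text \<open>
  A solution is a curve \<open>u\<close> in the phase space, defined on an open set \<open>S\<close> of complex times;
  the values of \<open>u\<close> outside \<open>S\<close> are irrelevant.
\<close>

definition solution_on ::
  "complex \<Rightarrow> complex \<Rightarrow> complex \<Rightarrow> complex \<Rightarrow> complex \<Rightarrow> complex set \<Rightarrow> (complex \<Rightarrow> state) \<Rightarrow> bool"
where
  "solution_on \<alpha>0 \<alpha>1 \<alpha>2 \<alpha>3 \<alpha>4 S u \<longleftrightarrow> open S \<and> (\<forall>t\<in>S.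
     ((\<lambda>t. f0 (u t)) has_field_derivative
        - (2 * f1 (u t) * g1 (u t) + \<alpha>1) * f0 (u t) - \<alpha>0 * f1 (u t)) (at t) \<and>
     ((\<lambda>t. f1 (u t)) has_field_derivative
        - (2 * f0 (u t) * g1 (u t) + \<alpha>0) * f1 (u t) - \<alpha>1 * f0 (u t)) (at t) \<and>
     ((\<lambda>t. f2 (u t)) has_field_derivative
        ((f0 (u t) + f1 (u t)) * g1 (u t) + (f3 (u t) + f4 (u t)) * g2 (u t) + 1) * f2 (u t)
          - 2 * \<alpha>2 * g1 (u t) * g2 (u t)) (at t) \<and>
     ((\<lambda>t. f3 (u t)) has_field_derivative
        - (2 * f4 (u t) * g2 (u t) + \<alpha>4) * f3 (u t) - \<alpha>3 * f4 (u t)) (at t) \<and>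
     ((\<lambda>t. f4 (u t)) has_field_derivative
        - (2 * f3 (u t) * g2 (u t) + \<alpha>3) * f4 (u t) - \<alpha>4 * f3 (u t)) (at t) \<and>
     ((\<lambda>t. g1 (u t)) has_field_derivative
        (f0 (u t) + f1 (u t)) * (g1 (u t))\<^sup>2
          - ((f3 (u t) + f4 (u t)) * g2 (u t) - \<alpha>0 - \<alpha>1) * g1 (u t)
          + (f3 (u t) + f4 (u t)) * f2 (u t)) (at t) \<and>
     ((\<lambda>t. g2 (u t)) has_field_derivative
        (f3 (u t) + f4 (u t)) * (g2 (u t))\<^sup>2
          - ((f0 (u t) + f1 (u t)) * g1 (u t) - \<alpha>3 - \<alpha>4) * g2 (u t)
          + (f0 (u t) + f1 (u t)) * f2 (u t)) (at t))"

text \<open>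
  A first integral is a non-constant function on the phase space that is constant along every
  solution. Connectedness of the time domain is needed here: on a disconnected open set the
  constant may differ from one component to another.
\<close>

definition first_integral ::
  "complex \<Rightarrow> complex \<Rightarrow> complex \<Rightarrow> complex \<Rightarrow> complex \<Rightarrow> (state \<Rightarrow> complex) \<Rightarrow> bool"
where
  "first_integral \<alpha>0 \<alpha>1 \<alpha>2 \<alpha>3 \<alpha>4 \<Phi> \<longleftrightarrow>
     (\<exists>p q. \<Phi> p \<noteq> \<Phi> q) \<and>
     (\<forall>S u. connected S \<longrightarrow> solution_on \<alpha>0 \<alpha>1 \<alpha>2 \<alpha>3 \<alpha>4 S u \<longrightarrow> (\<lambda>t. \<Phi> (u t)) constant_on S)"

end

theory Submission
  imports Defs
begin

text \<open>
  All three claims are identities between the right-hand sides of the system. The equations for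
  \<open>f0\<close> and \<open>f1\<close> have the same right-hand side
  \<open>- 2 f0 f1 g1 - \<alpha>1 f0 - \<alpha>0 f1\<close>, and those for \<open>f3\<close> and \<open>f4\<close> agree likewise, so the two
  differences have derivative zero and are constant on a connected domain. In the derivative of
  \<open>g1 g2\<close> the terms \<open>(f0 + f1) g1\<^sup>2 g2\<close> and \<open>(f3 + f4) g1 g2\<^sup>2\<close> occur with both signs and
  cancel, the terms with \<open>f2\<close> match those of the equation for \<open>f2\<close>, and there remains
  \<open>f2 - (\<alpha>0 + \<alpha>1 + 2 \<alpha>2 + \<alpha>3 + \<alpha>4) g1 g2\<close> as the derivative of \<open>f2 - g1 g2\<close>. The normalisation
  of the parameters turns this into \<open>f2 - g1 g2\<close>.
\<close>

lemma f0_minus_f1_has_derivative_zero: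
  assumes "solution_on \<alpha>0 \<alpha>1 \<alpha>2 \<alpha>3 \<alpha>4 S u" and "t \<in> S"
  shows "((\<lambda>t. f0 (u t) - f1 (u t)) has_field_derivative 0) (at t)"
proof -
  from assms have
    "((\<lambda>t. f0 (u t)) has_field_derivative
        - (2 * f1 (u t) * g1 (u t) + \<alpha>1) * f0 (u t) - \<alpha>0 * f1 (u t)) (at t)"
    "((\<lambda>t. f1 (u t)) has_field_derivative
        - (2 * f0 (u t) * g1 (u t) + \<alpha>0) * f1 (u t) - \<alpha>1 * f0 (u t)) (at t)"
    unfolding solution_on_def by blast+
  from DERIV_diff[OF this] show ?thesis
    by (rule DERIV_cong) (simp add: algebra_simps)
qed

lemma f3_minus_f4_has_derivative_zero:
  assumes "solution_on \<alpha>0 \<alpha>1 \<alpha>2 \<alpha>3 \<alpha>4 S u" and "t \<in> S"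
  shows "((\<lambda>t. f3 (u t) - f4 (u t)) has_field_derivative 0) (at t)"
proof -
  from assms have
    "((\<lambda>t. f3 (u t)) has_field_derivative
        - (2 * f4 (u t) * g2 (u t) + \<alpha>4) * f3 (u t) - \<alpha>3 * f4 (u t)) (at t)"
    "((\<lambda>t. f4 (u t)) has_field_derivative
        - (2 * f3 (u t) * g2 (u t) + \<alpha>3) * f4 (u t) - \<alpha>4 * f3 (u t)) (at t)"
    unfolding solution_on_def by blast+
  from DERIV_diff[OF this] show ?thesis
    by (rule DERIV_cong) (simp add: algebra_simps)
qed

text \<open>
  For arbitrary parameters the right-hand side shows where their sum enters: \<open>f2\<close> contributes
  \<open>2 \<alpha>2\<close> to the coefficient of \<open>g1 g2\<close>, while \<open>g1\<close> and \<open>g2\<close> contribute \<open>\<alpha>0 + \<alpha>1\<close> and \<open>\<alpha>3 + \<alpha>4\<close>.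
\<close>

lemma f2_minus_g1_g2_has_derivative:
  assumes "solution_on \<alpha>0 \<alpha>1 \<alpha>2 \<alpha>3 \<alpha>4 S u" and "t \<in> S"
  shows "((\<lambda>t. f2 (u t) - g1 (u t) * g2 (u t)) has_field_derivative
           f2 (u t) - (\<alpha>0 + \<alpha>1 + 2 * \<alpha>2 + \<alpha>3 + \<alpha>4) * (g1 (u t) * g2 (u t))) (at t)"
proof -
  from assms have f2:
    "((\<lambda>t. f2 (u t)) has_field_derivative
        ((f0 (u t) + f1 (u t)) * g1 (u t) + (f3 (u t) + f4 (u t)) * g2 (u t) + 1) * f2 (u t)
          - 2 * \<alpha>2 * g1 (u t) * g2 (u t)) (at t)"
    unfolding solution_on_def by blast
  from assms have g:
    "((\<lambda>t. g1 (u t)) has_field_derivative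
        (f0 (u t) + f1 (u t)) * (g1 (u t))\<^sup>2
          - ((f3 (u t) + f4 (u t)) * g2 (u t) - \<alpha>0 - \<alpha>1) * g1 (u t)
          + (f3 (u t) + f4 (u t)) * f2 (u t)) (at t)"
    "((\<lambda>t. g2 (u t)) has_field_derivative
        (f3 (u t) + f4 (u t)) * (g2 (u t))\<^sup>2
          - ((f0 (u t) + f1 (u t)) * g1 (u t) - \<alpha>3 - \<alpha>4) * g2 (u t)
          + (f0 (u t) + f1 (u t)) * f2 (u t)) (at t)"
    unfolding solution_on_def by blast+
  from DERIV_diff[OF f2 DERIV_mult[OF g]] show ?thesis
    by (rule DERIV_cong) (simp add: algebra_simps power2_eq_square)
qed

lemma first_integralI:
  assumes "\<Phi> p \<noteq> \<Phi> q"
    and "\<And>S u t. solution_on \<alpha>0 \<alpha>1 \<alpha>2 \<alpha>3 \<alpha>4 S u \<Longrightarrow> t \<in> S \<Longrightarrow>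
           ((\<lambda>t. \<Phi> (u t)) has_field_derivative 0) (at t)"
  shows "first_integral \<alpha>0 \<alpha>1 \<alpha>2 \<alpha>3 \<alpha>4 \<Phi>"
  unfolding first_integral_def
proof (intro conjI allI impI)
  show "\<exists>p q. \<Phi> p \<noteq> \<Phi> q"
    using assms(1) by blast
next
  fix S u
  assume S: "connected S" and sol: "solution_on \<alpha>0 \<alpha>1 \<alpha>2 \<alpha>3 \<alpha>4 S u"
  have "open S"
    using sol unfolding solution_on_def by blast
  with S assms(2)[OF sol] show "(\<lambda>t. \<Phi> (u t)) constant_on S"
    by (intro has_field_derivative_0_imp_constant_on)
qed

theorem theorem0p2:
  fixes \<alpha>0 \<alpha>1 \<alpha>2 \<alpha>3 \<alpha>4 :: complex
  assumes "\<alpha>0 + \<alpha>1 + 2 * \<alpha>2 + \<alpha>3 + \<alpha>4 = 1"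
  shows "first_integral \<alpha>0 \<alpha>1 \<alpha>2 \<alpha>3 \<alpha>4 (\<lambda>p. f0 p - f1 p) \<and>
         first_integral \<alpha>0 \<alpha>1 \<alpha>2 \<alpha>3 \<alpha>4 (\<lambda>p. f3 p - f4 p) \<and>
         (\<forall>S u. solution_on \<alpha>0 \<alpha>1 \<alpha>2 \<alpha>3 \<alpha>4 S u \<longrightarrow> (\<forall>t\<in>S.
            ((\<lambda>t. f0 (u t) - f1 (u t)) has_field_derivative 0) (at t) \<and>
            ((\<lambda>t. f3 (u t) - f4 (u t)) has_field_derivative 0) (at t) \<and>
            ((\<lambda>t. f2 (u t) - g1 (u t) * g2 (u t)) has_field_derivative
               f2 (u t) - g1 (u t) * g2 (u t)) (at t)))"
proof (intro conjI allI impI ballI)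
  show "first_integral \<alpha>0 \<alpha>1 \<alpha>2 \<alpha>3 \<alpha>4 (\<lambda>p. f0 p - f1 p)"
    by (rule first_integralI[where p = "State 1 0 0 0 0 0 0" and q = "State 0 0 0 0 0 0 0"])
      (simp_all add: f0_minus_f1_has_derivative_zero)
  show "first_integral \<alpha>0 \<alpha>1 \<alpha>2 \<alpha>3 \<alpha>4 (\<lambda>p. f3 p - f4 p)"
    by (rule first_integralI[where p = "State 0 0 0 1 0 0 0" and q = "State 0 0 0 0 0 0 0"])
      (simp_all add: f3_minus_f4_has_derivative_zero)
next
  fix S u t
  assume sol: "solution_on \<alpha>0 \<alpha>1 \<alpha>2 \<alpha>3 \<alpha>4 S u" and t: "t \<in> S"
  show "((\<lambda>t. f0 (u t) - f1 (u t)) has_field_derivative 0) (at t)"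
    using sol t by (rule f0_minus_f1_has_derivative_zero)
  show "((\<lambda>t. f3 (u t) - f4 (u t)) has_field_derivative 0) (at t)"
    using sol t by (rule f3_minus_f4_has_derivative_zero)
  show "((\<lambda>t. f2 (u t) - g1 (u t) * g2 (u t)) has_field_derivative
          f2 (u t) - g1 (u t) * g2 (u t)) (at t)"
    using f2_minus_g1_g2_has_derivative[OF sol t] assms by simp
qed

end
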